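(* Let $l>0$ be a constant, and let $u_0,v_0,f_0\in C^1(\mathbb{R}^2)\cap C_b(\mathbb{R}^2)$ be real-valued with $f_0>0$. Consider the Cauchy problem $$\frac{\partial u}{\partial t}+u\frac{\partial u}{\partial x}+v\frac{\partial u}{\partial y}-l v=0,\qquad \frac{\partial v}{\partial t}+u\frac{\partial v}{\partial x}+v\frac{\partial v}{\partial y}+l u=0,$$ $$u(0,x,y)=u_0(x,y),\qquad v(0,x,y)=v_0(x,y),\qquad (x,y)\in\mathbb{R}^2.$$ For $\sigma>0$, $t>0$ and $(x,y)\in\mathbb{R}^2$ define $$\hat u(t,x,y)=\frac{\int_{\mathbb{R}^2} f_0(s)\,q_1(t,s)\,H(t,s,x,y)\,ds}{\int_{\mathbb{R}^2} f_0(s)\,H(t,s,x,y)\,ds},\qquad \hat v(t,x,y)=\frac{\int_{\mathbb{R}^2} f_0(s)\,q_2(t,s)\,H(t,s,x,y)\,ds}{\int_{\mathbb{R}^2} f_0(s)\,H(t,s,x,y)\,ds},$$ where $s=(s_1,s_2)$, $$q_1(t,s)=u_0(s)\cos lt-v_0(s)\sin lt,\qquad q_2(t,s)=v_0(s)\cos lt+u_0(s)\sin lt,$$ $$H(t,s,x,y)=\exp\left(-\frac{\big(q_1(t,s)-u_0(s)+s_2-y\big)^2+\big(-q_2(t,s)+v_0(s)+s_1-x\big)^2}{2\sigma^2 t}\right).$$ Then the classical solution $(u,v)$ of the Cauchy problem can be obtained from this integral asymptotic representation by passing to the limit as $\sigma\to0$: as long as the solution $(u,v)$ remains smooth, $(\hat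 u(t,x,y),\hat v(t,x,y))$ tends to $(u(t,x,y),v(t,x,y))$ as $\sigma\to 0$ for every fixed $(t,x,y)$.
   Context: $C_b(\mathbb{R}^2)$ denotes the bounded continuous functions on $\mathbb{R}^2$. The system is the two-dimensional transport equation $\partial_t \mathbf{U}+(\mathbf{U},\nabla)\mathbf{U}+lL\mathbf{U}=0$ with $\mathbf{U}=(u,v)$ and $L=\begin{pmatrix}0&-1\\1&0\end{pmatrix}$, where $l>0$ is the Coriolis parameter. The functions $\hat u,\hat v$, which depend on $\sigma$, arise as the conditional expectation of the velocity, given position, for the characteristics of the system with Brownian noise of intensity $\sigma$ added to the position equations; $f_0$ plays the role of the initial probability density of the particle position.
   Formalization: The printed formulas fail (l=1, u_0=1, v_0=0 gives v=-sin t but v̂=sin t); here q_1=u_0 cos lt+v_0 sin lt, q_2=v_0 cos lt-u_0 sin lt, and in H the terms q_1-u_0 and -q_2+v_0 are divided by l, as the characteristics of the system require. *)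

theory Defs
  imports "HOL-Analysis.Analysis"
begin

definition C1_on :: "'a::real_normed_vector set \<Rightarrow> ('a \<Rightarrow> 'b::real_normed_vector) \<Rightarrow> bool" where
  "C1_on S f \<longleftrightarrow>
     (\<exists>f' :: 'a \<Rightarrow> 'a \<Rightarrow>\<^sub>L 'b.
        (\<forall>x\<in>S. (f has_derivative blinfun_apply (f' x)) (at x within S)) \<and> continuous_on S f')"

text \<open>
  A classical solution on the time interval \<open>[0, T)\<close> is continuously differentiable up to the
  initial time, with one-sided time derivative at \<open>t = 0\<close>.
\<close>
definition classical_solution ::
  "real \<Rightarrow> (real \<times> real \<Rightarrow> real) \<Rightarrow> (real \<times> real \<Rightarrow> real) \<Rightarrow> real \<Rightarrow>
   (real \<Rightarrow> real \<Rightarrow> real \<Rightarrow> real) \<Rightarrow> (real \<Rightarrow> real \<Rightarrow> real \<Rightarrow> real) \<Rightarrow> bool" where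
  "classical_solution l u0 v0 T u v \<longleftrightarrow>
     C1_on ({0..<T} \<times> UNIV) (\<lambda>(t, x, y). u t x y) \<and>
     C1_on ({0..<T} \<times> UNIV) (\<lambda>(t, x, y). v t x y) \<and>
     (\<forall>t x y. 0 < t \<and> t < T \<longrightarrow>
        deriv (\<lambda>t'. u t' x y) t + u t x y * deriv (\<lambda>x'. u t x' y) x
          + v t x y * deriv (\<lambda>y'. u t x y') y - l * v t x y = 0 \<and>
        deriv (\<lambda>t'. v t' x y) t + u t x y * deriv (\<lambda>x'. v t x' y) x
          + v t x y * deriv (\<lambda>y'. v t x y') y + l * u t x y = 0) \<and>
     (\<forall>x y. u 0 x y = u0 (x, y) \<and> v 0 x y = v0 (x, y))"

text \<open>
  The characteristics of the system are \<open>x' = u\<close>, \<open>y' = v\<close>, \<open>u' = l v\<close>, \<open>v' = - l u\<close>.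
  For the starting point \<open>s\<close> they give the velocity \<open>(q1, q2)\<close> and the position
  \<open>(s1 - (q2 - v0) / l, s2 + (q1 - u0) / l)\<close>.  With Brownian noise of intensity \<open>\<sigma>\<close> added to the
  position, \<open>H\<close> is, up to normalisation, the density of the position at time \<open>t\<close>.

  The source prints \<open>q1\<close> and \<open>q2\<close> with \<open>- sin\<close> and \<open>+ sin\<close> respectively, and \<open>H\<close> without the
  factor \<open>1 / l\<close>.  These formulas do not belong to the system above: for the constant data
  \<open>u0 = 1\<close>, \<open>v0 = 0\<close> the solution is \<open>v = - sin (l t)\<close>, but the printed ratio for the second
  component equals \<open>sin (l t)\<close> for every \<open>\<sigma>\<close>.
\<close>
definition q1 :: "real \<Rightarrow> (real \<times> real \<Rightarrow> real) \<Rightarrow> (real \<times> real \<Rightarrow> real) \<Rightarrow> real \<Rightarrow> real \<times> real \<Rightarrow> real" where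
  "q1 l u0 v0 t s = u0 s * cos (l * t) + v0 s * sin (l * t)"

definition q2 :: "real \<Rightarrow> (real \<times> real \<Rightarrow> real) \<Rightarrow> (real \<times> real \<Rightarrow> real) \<Rightarrow> real \<Rightarrow> real \<times> real \<Rightarrow> real" where
  "q2 l u0 v0 t s = v0 s * cos (l * t) - u0 s * sin (l * t)"

definition H ::
  "real \<Rightarrow> (real \<times> real \<Rightarrow> real) \<Rightarrow> (real \<times> real \<Rightarrow> real) \<Rightarrow> real \<Rightarrow>
   real \<Rightarrow> real \<times> real \<Rightarrow> real \<Rightarrow> real \<Rightarrow> real" where
  "H l u0 v0 \<sigma> t s x y =
     exp (- ((((q1 l u0 v0 t s - u0 s) / l + snd s - y)\<^sup>2
              + ((- q2 l u0 v0 t s + v0 s) / l + fst s - x)\<^sup>2) / (2 * \<sigma>\<^sup>2 * t)))"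

definition u_hat ::
  "real \<Rightarrow> (real \<times> real \<Rightarrow> real) \<Rightarrow> (real \<times> real \<Rightarrow> real) \<Rightarrow> (real \<times> real \<Rightarrow> real) \<Rightarrow> real \<Rightarrow>
   real \<Rightarrow> real \<Rightarrow> real \<Rightarrow> real" where
  "u_hat l u0 v0 f0 \<sigma> t x y =
     (LINT s|lborel. f0 s * q1 l u0 v0 t s * H l u0 v0 \<sigma> t s x y) /
     (LINT s|lborel. f0 s * H l u0 v0 \<sigma> t s x y)"

definition v_hat ::
  "real \<Rightarrow> (real \<times> real \<Rightarrow> real) \<Rightarrow> (real \<times> real \<Rightarrow> real) \<Rightarrow> (real \<times> real \<Rightarrow> real) \<Rightarrow> real \<Rightarrow>
   real \<Rightarrow> real \<Rightarrow> real \<Rightarrow> real" where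
  "v_hat l u0 v0 f0 \<sigma> t x y =
     (LINT s|lborel. f0 s * q2 l u0 v0 t s * H l u0 v0 \<sigma> t s x y) /
     (LINT s|lborel. f0 s * H l u0 v0 \<sigma> t s x y)"

end

theory Submission
  imports Defs "HOL-Probability.Distributions"
begin

text \<open>
  The explicit characteristics \<open>s \<mapsto> flow t s\<close> carry the velocity \<open>(q1, q2)\<close>, so
  \<open>q1 (t, s) = u (t, flow t s)\<close> and \<open>H\<close> is a Gaussian in \<open>flow t s - (x, y)\<close> of width \<open>\<sigma>\<close>. Thus \<open>u_hat\<close> is
  an average of \<open>u (t, \<cdot>)\<close> over points that concentrate at \<open>(x, y)\<close>. The concentration is Laplace's method
  and only needs some characteristic to reach \<open>(x, y)\<close>; this follows from Brouwer's fixed point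
  theorem, because \<open>flow t\<close> differs from the identity by a bounded continuous map.
\<close>

section \<open>Comparison for a differential inequality, and surjectivity of bounded perturbations
  of the identity\<close>

lemma C1_on_imp_continuous_on:
  assumes "C1_on S f"
  shows "continuous_on S f"
  using assms unfolding C1_on_def
  by (meson continuous_on_eq_continuous_within has_derivative_continuous)

text \<open>With the integrating factor \<open>exp (- K * x)\<close> the product is nonincreasing on
  the interval, which gives \<open>w b \<le> 0\<close>. The inequality is asked for in the open
  interval only, matching a solution whose equations hold for positive times and which is merely
  continuous up to time 0 here.\<close>

lemma gronwall_zero:
  fixes w w' :: "real \<Rightarrow> real"
  assumes "0 \<le> b" "continuous_on {0..b} w" "w 0 = 0" "0 \<le> w b"
    and deriv: "\<And>x. 0 < x \<Longrightarrow> x < b \<Longrightarrow> (w has_real_derivative w' x) (at x)"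
    and bound: "\<And>x. 0 < x \<Longrightarrow> x < b \<Longrightarrow> w' x \<le> K * w x"
  shows "w b = 0"
proof -
  have "exp (- K * b) * w b \<le> exp (- K * 0) * w 0"
  proof (rule DERIV_nonpos_imp_decreasing_open[OF \<open>0 \<le> b\<close>])
    fix x assume x: "0 < x" "x < b"
    have "((\<lambda>x. exp (- K * x) * w x) has_real_derivative exp (- K * x) * (w' x - K * w x)) (at x)"
      by (rule derivative_eq_intros deriv x refl | simp add: algebra_simps)+
    moreover have "exp (- K * x) * (w' x - K * w x) \<le> 0"
      using bound[OF x] by (simp add: mult_le_0_iff)
    ultimately show "\<exists>y. ((\<lambda>x. exp (- K * x) * w x) has_real_derivative y) (at x) \<and> y \<le> 0"
      by blast
  qed (intro continuous_intros assms)
  then show ?thesis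
    using assms by (simp add: mult_le_0_iff)
qed

text \<open>A solution of \<open>\<phi> s = p\<close> is the same as a fixed point of
  \<open>p + s - \<phi> s\<close>, and this map sends the whole space into the ball of radius
  \<open>C\<close> about \<open>p\<close>, so Brouwer applies.\<close>

lemma surj_bounded_perturbation:
  fixes \<phi> :: "'a::euclidean_space \<Rightarrow> 'a"
  assumes "continuous_on UNIV \<phi>" and bound: "\<And>s. norm (\<phi> s - s) \<le> C"
  obtains s where "\<phi> s = p"
proof -
  have "0 \<le> C" using bound[of 0] norm_ge_zero order_trans by blast
  obtain s where "p + s - \<phi> s = s"
  \<comment> \<open>The radius is \<open>C + 1\<close> because the ball must have positive radius
    even when \<open>C = 0\<close>.\<close>
  proof (rule brouwer_ball[of "C + 1" p "\<lambda>s. p + s - \<phi> s"])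
    show "(\<lambda>s. p + s - \<phi> s) \<in> cball p (C + 1) \<rightarrow> cball p (C + 1)"
    proof
      fix s
      have "dist p (p + s - \<phi> s) = norm (\<phi> s - s)"
        by (simp add: dist_norm)
      then show "p + s - \<phi> s \<in> cball p (C + 1)"
        using bound[of s] by simp
    qed
  qed (use \<open>0 \<le> C\<close> in \<open>auto intro!: continuous_on_diff continuous_on_add continuous_on_const continuous_on_id continuous_on_subset[OF assms(1)]\<close>)
  then have "\<phi> s = p" by (simp add: algebra_simps)
  with that show thesis .
qed

section \<open>Integrability of Gaussians in the plane\<close>

lemma integrable_gaussian:
  fixes c :: real
  assumes "c > 0"
  shows "integrable lborel (\<lambda>x. exp (- c * x\<^sup>2))"
proof -
  define \<sigma> where "\<sigma> = sqrt (1 / (2 * c))"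
  have \<sigma>: "\<sigma> > 0" "2 * \<sigma>\<^sup>2 = 1 / c" using assms by (auto simp: \<sigma>_def)
  have "integrable lborel (\<lambda>x. sqrt (2 * pi * \<sigma>\<^sup>2) * normal_density 0 \<sigma> x)"
    by (intro integrable_mult_right integrable_normal_density \<sigma>)
  moreover have "sqrt (2 * pi * \<sigma>\<^sup>2) * normal_density 0 \<sigma> x = exp (- c * x\<^sup>2)" for x
    using assms \<sigma> by (simp add: normal_density_def field_simps)
  ultimately show ?thesis by simp
qed

lemma integrable_gaussian_prod:
  fixes c :: real
  assumes "c > 0"
  shows "integrable lborel (\<lambda>s :: real \<times> real. exp (- c * (norm s)\<^sup>2))"
proof -
  have "integrable (lborel \<Otimes>\<^sub>M lborel) (\<lambda>(x::real, y::real). exp (- c * x\<^sup>2) * exp (- c * y\<^sup>2))"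
  proof (rule lborel_pair.Fubini_integrable)
    show "integrable lborel (\<lambda>x. LINT y|lborel. norm (case (x, y) of (x, y) \<Rightarrow> exp (- c * x\<^sup>2) * exp (- c * y\<^sup>2)))"
      using integrable_gaussian[OF assms] by simp
    show "AE x in lborel. integrable lborel (\<lambda>y. case (x, y) of (x, y) \<Rightarrow> exp (- c * x\<^sup>2) * exp (- c * y\<^sup>2))"
      using integrable_gaussian[OF assms] by simp
  qed measurable
  then show ?thesis
    by (simp add: lborel_prod case_prod_beta' norm_prod_def exp_add[symmetric] distrib_left)
qed

text \<open>Since \<open>norm s\<close> exceeds \<open>norm (\<phi> s - p)\<close> by at most
  \<open>C + norm p\<close>, squaring bounds the integrand by a constant times a centred Gaussian
  with the rate \<open>c\<close> halved; the halving pays for the cross term.\<close>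

lemma integrable_gaussian_perturbation:
  fixes \<phi> :: "real \<times> real \<Rightarrow> real \<times> real"
  assumes "c > 0" "continuous_on UNIV \<phi>" and bound: "\<And>s. norm (\<phi> s - s) \<le> C"
  shows "integrable lborel (\<lambda>s. exp (- c * (norm (\<phi> s - p))\<^sup>2))"
proof (rule Bochner_Integration.integrable_bound)
  let ?C = "C + norm p"
  show "integrable lborel (\<lambda>s :: real \<times> real. exp (c * ?C\<^sup>2) * exp (- (c / 2) * (norm s)\<^sup>2))"
    using assms by (intro integrable_mult_right integrable_gaussian_prod) auto
  have "- c * (norm (\<phi> s - p))\<^sup>2 \<le> c * ?C\<^sup>2 + - (c / 2) * (norm s)\<^sup>2" for s
  proof -
    have "norm s \<le> norm (\<phi> s - p) + ?C"
      using bound[of s] by norm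
    then have "(norm s)\<^sup>2 \<le> (norm (\<phi> s - p) + ?C)\<^sup>2"
      by (intro power_mono) auto
    also have "\<dots> \<le> 2 * (norm (\<phi> s - p))\<^sup>2 + 2 * ?C\<^sup>2"
      using sum_squares_bound[of "norm (\<phi> s - p)" ?C] by (simp add: power2_sum)
    finally have "c * (norm s)\<^sup>2 \<le> c * (2 * (norm (\<phi> s - p))\<^sup>2 + 2 * ?C\<^sup>2)"
      using \<open>c > 0\<close> by simp
    then show ?thesis by (simp add: algebra_simps)
  qed
  then show "AE s in lborel. norm (exp (- c * (norm (\<phi> s - p))\<^sup>2)) \<le>
      norm (exp (c * ?C\<^sup>2) * exp (- (c / 2) * (norm s)\<^sup>2))"
    by (simp add: exp_add[symmetric])
  show "(\<lambda>s. exp (- c * (norm (\<phi> s - p))\<^sup>2)) \<in> borel_measurable lborel"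
    using borel_measurable_continuous_onI[OF assms(2)] by simp
qed

section \<open>Laplace's method for a ratio of integrals\<close>

text \<open>
  The mass of \<open>{r \<ge> d}\<close> decays like \<open>exp (- (\<kappa> - 1) d)\<close>, whereas the total mass is at least a constant
  times \<open>exp (- (\<kappa> - 1) d / 2)\<close> because \<open>{r < d / 2}\<close> is not a null set.
\<close>
lemma laplace_ratio_tendsto:
  fixes w q r :: "'a \<Rightarrow> real"
  assumes [measurable]: "w \<in> borel_measurable M" "q \<in> borel_measurable M" "r \<in> borel_measurable M"
    and w: "\<And>s. w s > 0" and r: "\<And>s. r s \<ge> 0" and q: "\<And>s. \<bar>q s\<bar> \<le> B"
    and int: "integrable M (\<lambda>s. w s * exp (- r s))"
    and mass: "\<And>d. d > 0 \<Longrightarrow> emeasure M {s \<in> space M. r s < d} \<noteq> 0"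
    and lim: "\<And>e. e > 0 \<Longrightarrow> \<exists>d>0. \<forall>s. r s < d \<longrightarrow> \<bar>q s - c\<bar> \<le> e"
  shows "((\<lambda>\<kappa>. (LINT s|M. w s * q s * exp (- \<kappa> * r s)) / (LINT s|M. w s * exp (- \<kappa> * r s)))
    \<longlongrightarrow> c) at_top"
proof (rule tendstoI)
  have w0: "w s \<ge> 0" for s using w[of s] by simp
  fix e0 :: real assume "e0 > 0"
  \<comment> \<open>Half of the tolerance goes to the region where \<open>q\<close> is near
    \<open>c\<close>, the other half to the exponentially small tail.\<close>
  define e where "e = e0 / 2"
  have e: "e > 0" using \<open>e0 > 0\<close> by (simp add: e_def)
  obtain d where d: "d > 0" and near: "\<And>s. r s < d \<Longrightarrow> \<bar>q s - c\<bar> \<le> e"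
    using lim[OF e] by blast
  define K where "K = B + \<bar>c\<bar>"
  have qc: "\<bar>q s - c\<bar> \<le> K" for s using q[of s] by (simp add: K_def)
  have K: "K \<ge> 0" using qc[of undefined] by linarith
  define A where "A = (LINT s|M. w s * exp (- r s))"
  \<comment> \<open>The part of the mass near the minimum, on a sublevel set at half the height
    \<open>d\<close> of the splitting; the gap between the two heights produces the decay.\<close>
  define h where "h s = indicator {s \<in> space M. r s < d / 2} s * (w s * exp (- r s))" for s
  define m where "m = (LINT s|M. h s)"
  have int_h: "integrable M h"
    unfolding h_def using integrable_mult_indicator[OF _ int, of "{s \<in> space M. r s < d / 2}"] by simp
  have h0: "h s \<ge> 0" for s using w0[of s] by (simp add: h_def)
  \<comment> \<open>On its sublevel set \<open>h\<close> is strictly positive, so a zero integral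
    would make that set null, against \<open>mass\<close>.\<close>
  have "m \<noteq> 0"
  proof
    assume "m = 0"
    then have "AE s in M. h s = 0"
      using integral_nonneg_eq_0_iff_AE[OF int_h] h0 by (simp add: m_def)
    then have "AE s in M. \<not> r s < d / 2"
      by (rule AE_mp) (auto intro!: AE_I2 simp: h_def less_imp_neq[OF w, symmetric])
    then have "emeasure M {s \<in> space M. r s < d / 2} = 0"
      by (subst (asm) AE_iff_measurable[OF _ refl]) auto
    then show False using mass[of "d / 2"] d by simp
  qed
  moreover have "m \<ge> 0" unfolding m_def by (intro integral_nonneg_AE AE_I2 h0)
  ultimately have m: "m > 0" by simp
  \<comment> \<open>Integrability is known for \<open>\<kappa> = 1\<close>; for
    \<open>\<kappa> \<ge> 1\<close> the integrand is dominated by that one, and only the surplus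
    \<open>\<kappa> - 1\<close> yields decay.\<close>
  have bound: "\<bar>(LINT s|M. w s * q s * exp (- \<kappa> * r s)) / (LINT s|M. w s * exp (- \<kappa> * r s)) - c\<bar>
      \<le> e + K * A / m * exp (- (\<kappa> - 1) * (d / 2))" if "\<kappa> \<ge> 1" for \<kappa>
  proof -
    have dom: "w s * exp (- \<kappa> * r s) \<le> w s * exp (- r s)" for s
    proof (rule mult_left_mono)
      show "exp (- \<kappa> * r s) \<le> exp (- r s)"
        using mult_right_mono[OF that r[of s]] by simp
    qed (fact w0)
    have intD: "integrable M (\<lambda>s. w s * exp (- \<kappa> * r s))"
      by (rule Bochner_Integration.integrable_bound[OF int])
        (use dom w0 in \<open>simp_all add: abs_mult\<close>)
    have intN: "integrable M (\<lambda>s. w s * q s * exp (- \<kappa> * r s))"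
    proof (rule Bochner_Integration.integrable_bound)
      show "integrable M (\<lambda>s. B * (w s * exp (- \<kappa> * r s)))" using intD by simp
      have "\<bar>w s * q s * exp (- \<kappa> * r s)\<bar> \<le> \<bar>B * (w s * exp (- \<kappa> * r s))\<bar>" for s
      proof -
        have "\<bar>q s\<bar> * (w s * exp (- \<kappa> * r s)) \<le> \<bar>B\<bar> * (w s * exp (- \<kappa> * r s))"
          using q[of s] w0[of s] by (intro mult_right_mono) auto
        then show ?thesis using w[of s] by (simp add: abs_mult mult_ac)
      qed
      then show "AE s in M. norm (w s * q s * exp (- \<kappa> * r s)) \<le> norm (B * (w s * exp (- \<kappa> * r s)))"
        by simp
    qed measurable
    define N where "N = (LINT s|M. w s * q s * exp (- \<kappa> * r s))"
    define D where "D = (LINT s|M. w s * exp (- \<kappa> * r s))"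
    \<comment> \<open>Lower bound for the denominator: where \<open>r s < d / 2\<close>, the surplus
      factor \<open>exp (- (\<kappa> - 1) * r s)\<close> is at least its value at height
      \<open>d / 2\<close>.\<close>
    have "exp (- (\<kappa> - 1) * (d / 2)) * m \<le> D"
    proof -
      have "exp (- (\<kappa> - 1) * (d / 2)) * h s \<le> w s * exp (- \<kappa> * r s)" for s
      proof (cases "s \<in> space M \<and> r s < d / 2")
        case True
        then have "(\<kappa> - 1) * r s \<le> (\<kappa> - 1) * (d / 2)"
          using that by (intro mult_left_mono) auto
        then have "exp (- (\<kappa> - 1) * (d / 2)) * exp (- r s) \<le> exp (- \<kappa> * r s)"
          unfolding exp_add[symmetric] exp_le_cancel_iff by (simp add: field_simps)
        then have "w s * (exp (- (\<kappa> - 1) * (d / 2)) * exp (- r s)) \<le> w s * exp (- \<kappa> * r s)"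
          using w[of s] by (intro mult_left_mono) auto
        with True show ?thesis by (simp add: h_def mult_ac)
      next
        case False
        then show ?thesis using w0[of s] by (simp add: h_def)
      qed
      then have "(LINT s|M. exp (- (\<kappa> - 1) * (d / 2)) * h s) \<le> D"
        unfolding D_def by (intro integral_mono integrable_mult_right int_h intD)
      then show ?thesis by (simp add: m_def)
    qed
    moreover have "0 < exp (- (\<kappa> - 1) * (d / 2)) * m" using m by simp
    ultimately have D: "D > 0" and D_ge: "exp (- (\<kappa> - 1) * (d / 2)) * m \<le> D" by linarith+
    \<comment> \<open>Split at height \<open>d\<close>: below it \<open>q\<close> is within
      \<open>e\<close> of \<open>c\<close>; above it \<open>K\<close> bounds the deviation and the
      surplus factor is at most \<open>exp (- (\<kappa> - 1) * d)\<close>.\<close>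
    have pt: "\<bar>w s * q s * exp (- \<kappa> * r s) - c * (w s * exp (- \<kappa> * r s))\<bar>
        \<le> e * (w s * exp (- \<kappa> * r s)) + K * exp (- (\<kappa> - 1) * d) * (w s * exp (- r s))" for s
    proof -
      have eq: "\<bar>w s * q s * exp (- \<kappa> * r s) - c * (w s * exp (- \<kappa> * r s))\<bar>
          = \<bar>q s - c\<bar> * (w s * exp (- \<kappa> * r s))"
      proof -
        have "w s * q s * exp (- \<kappa> * r s) - c * (w s * exp (- \<kappa> * r s))
          = (q s - c) * (w s * exp (- \<kappa> * r s))" by (simp add: algebra_simps)
        then show ?thesis using w[of s] by (simp add: abs_mult)
      qed
      show ?thesis
      proof (cases "r s < d")
        case True
        then have "\<bar>q s - c\<bar> * (w s * exp (- \<kappa> * r s)) \<le> e * (w s * exp (- \<kappa> * r s))"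
          using near w[of s] by (intro mult_right_mono) auto
        moreover have "0 \<le> K * exp (- (\<kappa> - 1) * d) * (w s * exp (- r s))"
          using K w[of s] by simp
        ultimately show ?thesis unfolding eq by linarith
      next
        case False
        then have "(\<kappa> - 1) * d \<le> (\<kappa> - 1) * r s"
          using that by (intro mult_left_mono) auto
        then have "exp (- \<kappa> * r s) \<le> exp (- (\<kappa> - 1) * d) * exp (- r s)"
          unfolding exp_add[symmetric] exp_le_cancel_iff by (simp add: algebra_simps)
        then have "w s * exp (- \<kappa> * r s) \<le> w s * (exp (- (\<kappa> - 1) * d) * exp (- r s))"
          using w[of s] by (intro mult_left_mono) auto
        then have "\<bar>q s - c\<bar> * (w s * exp (- \<kappa> * r s))
            \<le> K * (w s * (exp (- (\<kappa> - 1) * d) * exp (- r s)))"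
          using qc[of s] K w[of s] by (intro mult_mono) auto
        moreover have "0 \<le> e * (w s * exp (- \<kappa> * r s))" using e w[of s] by simp
        ultimately show ?thesis unfolding eq by (simp add: mult_ac)
      qed
    qed
    have intcD: "integrable M (\<lambda>s. a * (w s * exp (- \<kappa> * r s)))" for a
      by (intro integrable_mult_right impI intD)
    have intA: "integrable M (\<lambda>s. K * exp (- (\<kappa> - 1) * d) * (w s * exp (- r s)))"
      by (intro integrable_mult_right impI int)
    have "\<bar>N - c * D\<bar> = \<bar>LINT s|M. w s * q s * exp (- \<kappa> * r s) - c * (w s * exp (- \<kappa> * r s))\<bar>"
      by (simp only: N_def D_def Bochner_Integration.integral_diff[OF intN intcD] integral_mult_right_zero)
    also have "\<dots> \<le> (LINT s|M. \<bar>w s * q s * exp (- \<kappa> * r s) - c * (w s * exp (- \<kappa> * r s))\<bar>)"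
      by (rule integral_abs_bound)
    also have "\<dots> \<le> (LINT s|M. e * (w s * exp (- \<kappa> * r s))
        + K * exp (- (\<kappa> - 1) * d) * (w s * exp (- r s)))"
      by (rule integral_mono[OF integrable_abs[OF Bochner_Integration.integrable_diff[OF intN intcD]]
            Bochner_Integration.integrable_add[OF intcD intA] pt])
    also have "\<dots> = e * D + K * exp (- (\<kappa> - 1) * d) * A"
      by (simp only: D_def A_def Bochner_Integration.integral_add[OF intcD intA] integral_mult_right_zero)
    finally have ND: "\<bar>N - c * D\<bar> \<le> e * D + K * exp (- (\<kappa> - 1) * d) * A" .
    have "A \<ge> 0" unfolding A_def using w0 by (intro integral_nonneg_AE AE_I2) simp
    \<comment> \<open>The tail factor is the square of
      \<open>exp (- (\<kappa> - 1) * (d / 2))\<close>. One copy, together with \<open>m\<close>, is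
      absorbed into \<open>D\<close>; the other survives division by \<open>D\<close> and tends to
      0.\<close>
    have "K * exp (- (\<kappa> - 1) * d) * A = K * A / m * exp (- (\<kappa> - 1) * (d / 2)) * (exp (- (\<kappa> - 1) * (d / 2)) * m)"
    proof -
      have "exp (- (\<kappa> - 1) * d) = exp (- (\<kappa> - 1) * (d / 2)) * exp (- (\<kappa> - 1) * (d / 2))"
        by (simp only: exp_add[symmetric]) simp
      moreover have "K * (E * E) * A = K * A / m * E * (E * m)" for E
        using m by simp
      ultimately show ?thesis by (simp only:)
    qed
    also have "\<dots> \<le> K * A / m * exp (- (\<kappa> - 1) * (d / 2)) * D"
      using D_ge K \<open>A \<ge> 0\<close> m by (intro mult_left_mono) auto
    finally have "\<bar>N - c * D\<bar> \<le> (e + K * A / m * exp (- (\<kappa> - 1) * (d / 2))) * D"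
      using ND by (simp add: distrib_right)
    moreover have "N / D - c = (N - c * D) / D" using D by (simp add: diff_divide_distrib)
    ultimately have "\<bar>N / D - c\<bar> \<le> e + K * A / m * exp (- (\<kappa> - 1) * (d / 2))"
      using D by (simp only: abs_divide abs_of_pos pos_divide_le_eq)
    then show ?thesis by (simp only: N_def D_def)
  qed
  have "((\<lambda>\<kappa>. e + K * A / m * exp (- (\<kappa> - 1) * (d / 2))) \<longlongrightarrow> e) at_top"
  proof -
    have "filterlim (\<lambda>\<kappa>. d / 2 * (- 1 + \<kappa>)) at_top at_top"
      using d by (intro filterlim_tendsto_pos_mult_at_top[OF tendsto_const]
          filterlim_tendsto_add_at_top[OF tendsto_const filterlim_ident]) simp
    then have "filterlim (\<lambda>\<kappa>. - (d / 2 * (- 1 + \<kappa>))) at_bot at_top"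
      by (simp only: filterlim_uminus_at_top)
    then have "((\<lambda>\<kappa>. exp (- (d / 2 * (- 1 + \<kappa>)))) \<longlongrightarrow> 0) at_top"
      by (rule filterlim_compose[OF exp_at_bot])
    from tendsto_add[OF tendsto_const[of e] tendsto_mult_right_zero[OF this, of "K * A / m"]]
    have "((\<lambda>\<kappa>. e + K * A / m * exp (- (d / 2 * (- 1 + \<kappa>)))) \<longlongrightarrow> e) at_top"
      by (simp only: add_0_right)
    moreover have "- (\<kappa> - 1) * (d / 2) = - (d / 2 * (- 1 + \<kappa>))" for \<kappa>
      by (simp add: field_simps)
    ultimately show ?thesis by (simp only:)
  qed
  then have "eventually (\<lambda>\<kappa>. e + K * A / m * exp (- (\<kappa> - 1) * (d / 2)) < e0) at_top"
    by (rule order_tendstoD) (use \<open>e0 > 0\<close> in \<open>simp add: e_def\<close>)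
  then show "eventually (\<lambda>\<kappa>. dist ((LINT s|M. w s * q s * exp (- \<kappa> * r s)) /
      (LINT s|M. w s * exp (- \<kappa> * r s))) c < e0) at_top"
    using eventually_ge_at_top[of 1]
  proof eventually_elim
    case (elim \<kappa>)
    then show ?case using bound[of \<kappa>] unfolding dist_real_def by linarith
  qed
qed

section \<open>The classical solution along the explicit characteristics\<close>

text \<open>Turns the equations in partial derivatives into statements on the total derivative in
  the direction \<open>(1, u, v)\<close>, ready for the chain rule along a curve. Continuity of
  \<open>F\<close> and \<open>G\<close> up to time 0 is kept for a compactness bound.\<close>

lemma classical_solution_derivatives:
  assumes "classical_solution l u0 v0 T u v"
  obtains F G :: "real \<times> real \<times> real \<Rightarrow> (real \<times> real \<times> real) \<Rightarrow>\<^sub>L real"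
  where "continuous_on ({0..<T} \<times> UNIV) F" "continuous_on ({0..<T} \<times> UNIV) G"
    and "\<And>t x y. 0 < t \<Longrightarrow> t < T \<Longrightarrow> ((\<lambda>(t, x, y). u t x y) has_derivative F (t, x, y)) (at (t, x, y))"
    and "\<And>t x y. 0 < t \<Longrightarrow> t < T \<Longrightarrow> ((\<lambda>(t, x, y). v t x y) has_derivative G (t, x, y)) (at (t, x, y))"
    and "\<And>t x y. 0 < t \<Longrightarrow> t < T \<Longrightarrow> F (t, x, y) (1, u t x y, v t x y) = l * v t x y"
    and "\<And>t x y. 0 < t \<Longrightarrow> t < T \<Longrightarrow> G (t, x, y) (1, u t x y, v t x y) = - l * u t x y"
proof -
  let ?S = "{0..<T} \<times> (UNIV :: (real \<times> real) set)"
  have "C1_on ?S (\<lambda>(t, x, y). u t x y)" "C1_on ?S (\<lambda>(t, x, y). v t x y)"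
    using assms by (simp_all add: classical_solution_def)
  then obtain F G :: "real \<times> real \<times> real \<Rightarrow> (real \<times> real \<times> real) \<Rightarrow>\<^sub>L real"
    where F: "\<And>z. z \<in> ?S \<Longrightarrow> ((\<lambda>(t, x, y). u t x y) has_derivative F z) (at z within ?S)"
      and G: "\<And>z. z \<in> ?S \<Longrightarrow> ((\<lambda>(t, x, y). v t x y) has_derivative G z) (at z within ?S)"
      and cont: "continuous_on ?S F" "continuous_on ?S G"
    unfolding C1_on_def by metis
  \<comment> \<open>Positive times are interior to the strip, so the one-sided derivative there is
    the full one.\<close>
  have at: "at (t, x, y) within ?S = at (t, x, y)" if "0 < t" "t < T" for t x y
    using that by (intro at_within_interior) (simp add: interior_Times)
  have partial: "deriv (\<lambda>t'. w t' x y) t + a * deriv (\<lambda>x'. w t x' y) x + b * deriv (\<lambda>y'. w t x y') y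
      = L (1, a, b)"
    if w: "((\<lambda>(t, x, y). w t x y) has_derivative L) (at (t, x, y))"
    for w :: "real \<Rightarrow> real \<Rightarrow> real \<Rightarrow> real" and L t x y a b
  proof -
    interpret bounded_linear L using w by (rule has_derivative_bounded_linear)
    have scale: "L (c * d, c * d', c * d'') = c * L (d, d', d'')" for c d d' d''
      using scaleR[of c "(d, d', d'')"] by simp
    have "((\<lambda>t'. w t' x y) has_derivative (\<lambda>h. L (h, 0, 0))) (at t)"
      using has_derivative_compose[of "\<lambda>t'. (t', x, y)" "\<lambda>h. (h, 0, 0)" t UNIV, OF _ w]
      by (simp add: has_derivative_Pair)
    then have 1: "deriv (\<lambda>t'. w t' x y) t = L (1, 0, 0)"
      by (intro DERIV_imp_deriv has_derivative_imp_has_field_derivative)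
        (simp_all add: scale[symmetric])
    have "((\<lambda>x'. w t x' y) has_derivative (\<lambda>h. L (0, h, 0))) (at x)"
      using has_derivative_compose[of "\<lambda>x'. (t, x', y)" "\<lambda>h. (0, h, 0)" x UNIV, OF _ w]
      by (simp add: has_derivative_Pair)
    then have 2: "deriv (\<lambda>x'. w t x' y) x = L (0, 1, 0)"
      by (intro DERIV_imp_deriv has_derivative_imp_has_field_derivative)
        (simp_all add: scale[symmetric])
    have "((\<lambda>y'. w t x y') has_derivative (\<lambda>h. L (0, 0, h))) (at y)"
      using has_derivative_compose[of "\<lambda>y'. (t, x, y')" "\<lambda>h. (0, 0, h)" y UNIV, OF _ w]
      by (simp add: has_derivative_Pair)
    then have 3: "deriv (\<lambda>y'. w t x y') y = L (0, 0, 1)"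
      by (intro DERIV_imp_deriv has_derivative_imp_has_field_derivative)
        (simp_all add: scale[symmetric])
    have "L (1, a, b) = L (1, 0, 0) + L (0, a, 0) + L (0, 0, b)"
      by (simp add: add[symmetric])
    then show ?thesis
      unfolding 1 2 3 using scale[of a 0 1 0] scale[of b 0 0 1] by simp
  qed
  show thesis
  proof
    show F': "((\<lambda>(t, x, y). u t x y) has_derivative F (t, x, y)) (at (t, x, y))"
      if "0 < t" "t < T" for t x y
      using F[of "(t, x, y)"] at[OF that] that by simp
    show G': "((\<lambda>(t, x, y). v t x y) has_derivative G (t, x, y)) (at (t, x, y))"
      if "0 < t" "t < T" for t x y
      using G[of "(t, x, y)"] at[OF that] that by simp
    show "F (t, x, y) (1, u t x y, v t x y) = l * v t x y" if "0 < t" "t < T" for t x y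
    proof -
      have "deriv (\<lambda>t'. u t' x y) t + u t x y * deriv (\<lambda>x'. u t x' y) x
          + v t x y * deriv (\<lambda>y'. u t x y') y - l * v t x y = 0"
        using assms that unfolding classical_solution_def by blast
      then show ?thesis using partial[OF F'[OF that, of x y], of "u t x y" "v t x y"] by linarith
    qed
    show "G (t, x, y) (1, u t x y, v t x y) = - l * u t x y" if "0 < t" "t < T" for t x y
    proof -
      have "deriv (\<lambda>t'. v t' x y) t + u t x y * deriv (\<lambda>x'. v t x' y) x
          + v t x y * deriv (\<lambda>y'. v t x y') y + l * u t x y = 0"
        using assms that unfolding classical_solution_def by blast
      then show ?thesis using partial[OF G'[OF that, of x y], of "u t x y" "v t x y"] by linarith
    qed
  qed (fact cont)+
qed

text \<open>Because \<open>q1' = l * q2\<close> and \<open>q2' = - l * q1\<close> in time, these are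
  \<open>s\<close> plus the time integrals of \<open>q1\<close> and \<open>q2\<close> in closed
  form. The squares in \<open>H\<close> are those of the components of
  \<open>flow l u0 v0 t s - (x, y)\<close>.\<close>

definition flow :: "real \<Rightarrow> (real \<times> real \<Rightarrow> real) \<Rightarrow> (real \<times> real \<Rightarrow> real) \<Rightarrow> real \<Rightarrow>
    real \<times> real \<Rightarrow> real \<times> real" where
  "flow l u0 v0 t s = ((- q2 l u0 v0 t s + v0 s) / l + fst s, (q1 l u0 v0 t s - u0 s) / l + snd s)"

text \<open>
  No existence theory for the characteristic equations is needed: along the explicit curve
  \<open>flow\<close> the defect \<open>W = (u - q1, v - q2)\<close> satisfies a linear homogeneous equation, and \<open>W = 0\<close> at time \<open>0\<close>.
\<close>
lemma classical_solution_along_flow: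
  assumes l: "l > 0" and sol: "classical_solution l u0 v0 T u v" and t: "0 \<le> t" "t < T"
  shows "(\<lambda>(x, y). u t x y) (flow l u0 v0 t s) = q1 l u0 v0 t s"
    and "(\<lambda>(x, y). v t x y) (flow l u0 v0 t s) = q2 l u0 v0 t s"
proof -
  let ?S = "{0..<T} \<times> (UNIV :: (real \<times> real) set)"
  obtain F G :: "real \<times> real \<times> real \<Rightarrow> (real \<times> real \<times> real) \<Rightarrow>\<^sub>L real"
    where cont: "continuous_on ?S F" "continuous_on ?S G"
    and F: "\<And>t x y. 0 < t \<Longrightarrow> t < T \<Longrightarrow> ((\<lambda>(t, x, y). u t x y) has_derivative F (t, x, y)) (at (t, x, y))"
    and G: "\<And>t x y. 0 < t \<Longrightarrow> t < T \<Longrightarrow> ((\<lambda>(t, x, y). v t x y) has_derivative G (t, x, y)) (at (t, x, y))"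
    and Feq: "\<And>t x y. 0 < t \<Longrightarrow> t < T \<Longrightarrow> F (t, x, y) (1, u t x y, v t x y) = l * v t x y"
    and Geq: "\<And>t x y. 0 < t \<Longrightarrow> t < T \<Longrightarrow> G (t, x, y) (1, u t x y, v t x y) = - l * u t x y"
    by (rule classical_solution_derivatives[OF sol]) blast
  define Q1 where "Q1 \<tau> = q1 l u0 v0 \<tau> s" for \<tau>
  define Q2 where "Q2 \<tau> = q2 l u0 v0 \<tau> s" for \<tau>
  define X where "X \<tau> = (- Q2 \<tau> + v0 s) / l + fst s" for \<tau>
  define Y where "Y \<tau> = (Q1 \<tau> - u0 s) / l + snd s" for \<tau>
  define P where "P \<tau> = (\<tau>, X \<tau>, Y \<tau>)" for \<tau>
  have Q1': "(Q1 has_real_derivative l * Q2 \<tau>) (at \<tau> within A)" for \<tau> A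
    unfolding Q1_def[abs_def] Q2_def q1_def q2_def
    by (auto intro!: derivative_eq_intros simp: algebra_simps)
  have Q2': "(Q2 has_real_derivative - l * Q1 \<tau>) (at \<tau> within A)" for \<tau> A
    unfolding Q2_def[abs_def] Q1_def q1_def q2_def
    by (auto intro!: derivative_eq_intros simp: algebra_simps)
  have X': "(X has_real_derivative Q1 \<tau>) (at \<tau> within A)" for \<tau> A
    unfolding X_def[abs_def] using l by (auto intro!: derivative_eq_intros Q2')
  have Y': "(Y has_real_derivative Q2 \<tau>) (at \<tau> within A)" for \<tau> A
    unfolding Y_def[abs_def] using l by (auto intro!: derivative_eq_intros Q1')
  have contQXY: "continuous_on A Q1" "continuous_on A Q2" "continuous_on A X" "continuous_on A Y" for A
    by (rule DERIV_continuous_on, rule Q1' Q2' X' Y')+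
  have contP: "continuous_on A P" for A
    unfolding P_def[abs_def] by (intro continuous_intros contQXY)
  have PS: "P ` {0..t} \<subseteq> ?S" using t by (auto simp: P_def)
  define W1 where "W1 \<tau> = u \<tau> (X \<tau>) (Y \<tau>) - Q1 \<tau>" for \<tau>
  define W2 where "W2 \<tau> = v \<tau> (X \<tau>) (Y \<tau>) - Q2 \<tau>" for \<tau>
  have "continuous_on {0..t} (\<lambda>\<tau>. (\<lambda>(t, x, y). u t x y) (P \<tau>))"
    "continuous_on {0..t} (\<lambda>\<tau>. (\<lambda>(t, x, y). v t x y) (P \<tau>))"
    using sol unfolding classical_solution_def
    by (auto intro!: continuous_on_compose2[OF C1_on_imp_continuous_on contP PS])
  then have contW: "continuous_on {0..t} W1" "continuous_on {0..t} W2"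
    unfolding W1_def[abs_def] W2_def[abs_def] P_def by (auto intro!: continuous_on_diff contQXY)
  \<comment> \<open>The curve over the closed interval is compact and stays in the strip since
    \<open>t < T\<close>, so the derivatives are bounded along it, time 0 included.\<close>
  have "\<exists>K. \<forall>\<tau>\<in>{0..t}. norm (E (P \<tau>)) \<le> K" if "continuous_on ?S E"
    for E :: "real \<times> real \<times> real \<Rightarrow> (real \<times> real \<times> real) \<Rightarrow>\<^sub>L real"
  proof -
    have "compact ((\<lambda>\<tau>. E (P \<tau>)) ` {0..t})"
      by (intro compact_continuous_image continuous_on_compose2[OF that contP PS]) auto
    then show ?thesis by (auto dest!: compact_imp_bounded simp: bounded_iff)
  qed
  from this[OF cont(1)] this[OF cont(2)] obtain K1 K2
    where K1: "\<And>\<tau>. \<tau> \<in> {0..t} \<Longrightarrow> norm (F (P \<tau>)) \<le> K1"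
      and K2: "\<And>\<tau>. \<tau> \<in> {0..t} \<Longrightarrow> norm (G (P \<tau>)) \<le> K2" by metis
  define W where "W \<tau> = (W1 \<tau>)\<^sup>2 + (W2 \<tau>)\<^sup>2" for \<tau>
  have chain: "((\<lambda>\<tau>. w \<tau> (X \<tau>) (Y \<tau>)) has_real_derivative L (1, Q1 \<tau>, Q2 \<tau>)) (at \<tau>)"
    if "((\<lambda>(t, x, y). w t x y) has_derivative L) (at (P \<tau>))"
    for w :: "real \<Rightarrow> real \<Rightarrow> real \<Rightarrow> real" and L \<tau>
  proof -
    interpret bounded_linear L using that by (rule has_derivative_bounded_linear)
    have "(P has_derivative (\<lambda>h. (h, Q1 \<tau> * h, Q2 \<tau> * h))) (at \<tau>)"
      unfolding P_def[abs_def]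
      by (intro has_derivative_Pair has_derivative_ident has_field_derivative_imp_has_derivative X' Y')
    from has_derivative_compose[OF this that]
    have "((\<lambda>\<tau>. w \<tau> (X \<tau>) (Y \<tau>)) has_derivative (\<lambda>h. L (h, Q1 \<tau> * h, Q2 \<tau> * h))) (at \<tau>)"
      by (simp add: P_def)
    moreover have "h * L (1, Q1 \<tau>, Q2 \<tau>) = L (h, Q1 \<tau> * h, Q2 \<tau> * h)" for h
      using scaleR[of h "(1, Q1 \<tau>, Q2 \<tau>)"] by (simp add: mult.commute)
    ultimately show ?thesis
      by (rule has_derivative_imp_has_field_derivative)
  qed
  \<comment> \<open>The curve moves in direction \<open>(1, Q1, Q2)\<close> while the equations
    speak of direction \<open>(1, u, v)\<close>; \<open>Z\<close> is the difference. By linearity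
    its contribution is proportional to the defect itself.\<close>
  define Z where "Z \<tau> = (0 :: real, W1 \<tau>, W2 \<tau>)" for \<tau>
  have split: "(1, Q1 \<tau>, Q2 \<tau>) = (1, u \<tau> (X \<tau>) (Y \<tau>), v \<tau> (X \<tau>) (Y \<tau>)) - Z \<tau>" for \<tau>
    by (simp add: Z_def W1_def W2_def)
  have W1': "(W1 has_real_derivative l * W2 \<tau> - F (P \<tau>) (Z \<tau>)) (at \<tau>)" if "0 < \<tau>" "\<tau> < t" for \<tau>
  proof -
    have "F (P \<tau>) (1, Q1 \<tau>, Q2 \<tau>) = l * v \<tau> (X \<tau>) (Y \<tau>) - F (P \<tau>) (Z \<tau>)"
      using Feq[of \<tau> "X \<tau>" "Y \<tau>"] that t unfolding split blinfun.diff_right by (simp add: P_def)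
    with chain[of u "F (P \<tau>)" \<tau>] F[of \<tau> "X \<tau>" "Y \<tau>"] that t
    have "((\<lambda>\<tau>. u \<tau> (X \<tau>) (Y \<tau>)) has_real_derivative l * v \<tau> (X \<tau>) (Y \<tau>) - F (P \<tau>) (Z \<tau>)) (at \<tau>)"
      by (simp add: P_def)
    from DERIV_diff[OF this Q1'] show ?thesis
      by (simp add: W1_def[abs_def] W2_def algebra_simps)
  qed
  have W2': "(W2 has_real_derivative - l * W1 \<tau> - G (P \<tau>) (Z \<tau>)) (at \<tau>)" if "0 < \<tau>" "\<tau> < t" for \<tau>
  proof -
    have "G (P \<tau>) (1, Q1 \<tau>, Q2 \<tau>) = - l * u \<tau> (X \<tau>) (Y \<tau>) - G (P \<tau>) (Z \<tau>)"
      using Geq[of \<tau> "X \<tau>" "Y \<tau>"] that t unfolding split blinfun.diff_right by (simp add: P_def)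
    with chain[of v "G (P \<tau>)" \<tau>] G[of \<tau> "X \<tau>" "Y \<tau>"] that t
    have "((\<lambda>\<tau>. v \<tau> (X \<tau>) (Y \<tau>)) has_real_derivative - l * u \<tau> (X \<tau>) (Y \<tau>) - G (P \<tau>) (Z \<tau>)) (at \<tau>)"
      by (simp add: P_def)
    from DERIV_diff[OF this Q2'] show ?thesis
      by (simp add: W2_def[abs_def] W1_def algebra_simps)
  qed
  have "W t = 0"
  \<comment> \<open>In the derivative of the squared defect the rotation terms
    \<open>2 * l * W1 * W2\<close> cancel. What remains is bilinear in the defect and
    \<open>Z\<close>, whose norm is \<open>sqrt W\<close>, so the bounds on \<open>F\<close> and
    \<open>G\<close> give the rate.\<close>
  proof (rule gronwall_zero[of t W "\<lambda>\<tau>. - 2 * W1 \<tau> * F (P \<tau>) (Z \<tau>) - 2 * W2 \<tau> * G (P \<tau>) (Z \<tau>)" "2 * K1 + 2 * K2"])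
    show "continuous_on {0..t} W" unfolding W_def[abs_def] by (intro continuous_intros contW)
    show "W 0 = 0"
      using sol by (simp add: W_def W1_def W2_def X_def Y_def Q1_def Q2_def q1_def q2_def classical_solution_def)
    show "0 \<le> W t" by (simp add: W_def)
    fix \<tau> assume \<tau>: "0 < \<tau>" "\<tau> < t"
    show "(W has_real_derivative - 2 * W1 \<tau> * F (P \<tau>) (Z \<tau>) - 2 * W2 \<tau> * G (P \<tau>) (Z \<tau>)) (at \<tau>)"
      unfolding W_def[abs_def]
      by (rule DERIV_cong[OF DERIV_add[OF DERIV_power[OF W1'[OF \<tau>]] DERIV_power[OF W2'[OF \<tau>]]]])
        (simp add: algebra_simps)
    have nZ: "norm (Z \<tau>) = sqrt (W \<tau>)"
      by (simp add: Z_def W_def norm_Pair)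
    have est: "- 2 * a * E (Z \<tau>) \<le> 2 * K * W \<tau>"
      if "norm E \<le> K" "\<bar>a\<bar> \<le> sqrt (W \<tau>)" for a K and E :: "(real \<times> real \<times> real) \<Rightarrow>\<^sub>L real"
    proof -
      have "\<bar>E (Z \<tau>)\<bar> \<le> K * sqrt (W \<tau>)"
        using norm_blinfun[of E "Z \<tau>"] mult_right_mono[OF that(1), of "sqrt (W \<tau>)"]
        by (simp add: nZ W_def)
      then have "\<bar>a\<bar> * \<bar>E (Z \<tau>)\<bar> \<le> sqrt (W \<tau>) * (K * sqrt (W \<tau>))"
        using that by (intro mult_mono) (auto simp: W_def)
      also have "\<dots> = K * W \<tau>" by (simp add: W_def)
      finally have "\<bar>a * E (Z \<tau>)\<bar> \<le> K * W \<tau>" by (simp add: abs_mult)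
      then show ?thesis by linarith
    qed
    have "\<bar>W1 \<tau>\<bar> \<le> sqrt (W \<tau>)" "\<bar>W2 \<tau>\<bar> \<le> sqrt (W \<tau>)"
      by (auto simp: W_def intro!: real_le_rsqrt)
    with est[of "F (P \<tau>)" K1 "W1 \<tau>"] est[of "G (P \<tau>)" K2 "W2 \<tau>"] K1[of \<tau>] K2[of \<tau>] \<tau>
    have "- 2 * W1 \<tau> * F (P \<tau>) (Z \<tau>) \<le> 2 * K1 * W \<tau>" "- 2 * W2 \<tau> * G (P \<tau>) (Z \<tau>) \<le> 2 * K2 * W \<tau>"
      by auto
    then
    show "- 2 * W1 \<tau> * F (P \<tau>) (Z \<tau>) - 2 * W2 \<tau> * G (P \<tau>) (Z \<tau>) \<le> (2 * K1 + 2 * K2) * W \<tau>"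
      unfolding distrib_right by linarith
  qed (fact t)
  then have "W1 t = 0" "W2 t = 0" by (auto simp: W_def sum_power2_eq_zero_iff)
  then show "(\<lambda>(x, y). u t x y) (flow l u0 v0 t s) = q1 l u0 v0 t s"
    and "(\<lambda>(x, y). v t x y) (flow l u0 v0 t s) = q2 l u0 v0 t s"
    by (simp_all add: flow_def W1_def W2_def X_def Y_def Q1_def Q2_def)
qed

section \<open>Concentration of the Gaussian averages as the noise vanishes\<close>

text \<open>Laplace's method with large parameter \<open>1 / \<sigma>^2\<close>. Several
  \<open>s\<close> may be mapped to \<open>p\<close>, but weight exponent and averaged quantity both
  depend on \<open>s\<close> through \<open>\<phi> s\<close>, so all of them contribute the same
  value \<open>g p\<close>.\<close>

lemma gaussian_average_tendsto:
  fixes \<phi> :: "real \<times> real \<Rightarrow> real \<times> real" and f g :: "real \<times> real \<Rightarrow> real"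
  assumes t: "t > 0"
    and \<phi>: "continuous_on UNIV \<phi>" "\<And>s. norm (\<phi> s - s) \<le> C"
    and f: "f \<in> bcontfun" "\<And>s. f s > 0"
    and g: "continuous_on UNIV g" "\<And>s. \<bar>g (\<phi> s)\<bar> \<le> B"
  shows "((\<lambda>\<sigma>. (LINT s|lborel. f s * g (\<phi> s) * exp (- ((norm (\<phi> s - p))\<^sup>2 / (2 * \<sigma>\<^sup>2 * t)))) /
    (LINT s|lborel. f s * exp (- ((norm (\<phi> s - p))\<^sup>2 / (2 * \<sigma>\<^sup>2 * t))))) \<longlongrightarrow> g p) (at_right 0)"
proof -
  define r where "r s = (norm (\<phi> s - p))\<^sup>2 / (2 * t)" for s
  \<comment> \<open>This also holds at \<open>\<sigma> = 0\<close>, where division by zero makes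
    both sides 0, so it can be used as an unconditional rewrite.\<close>
  have r_eq: "- ((norm (\<phi> s - p))\<^sup>2 / (2 * \<sigma>\<^sup>2 * t)) = - (inverse (\<sigma>\<^sup>2)) * r s" for \<sigma> s
    by (simp add: r_def field_simps)
  have cont_r: "continuous_on UNIV r"
    unfolding r_def[abs_def] using t by (intro continuous_intros \<phi>) auto
  have cont_f: "continuous_on UNIV f" and bdd_f: "bounded (range f)"
    using f by (auto simp: bcontfun_def)
  have meas: "h \<in> borel_measurable lborel" if "continuous_on UNIV h" for h :: "real \<times> real \<Rightarrow> real"
    using borel_measurable_continuous_onI[OF that] by simp
  obtain M where M: "\<And>s. \<bar>f s\<bar> \<le> M"
    using bdd_f by (auto simp: bounded_iff)
  obtain s0 where s0: "\<phi> s0 = p"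
    using surj_bounded_perturbation[OF \<phi>] .
  have "((\<lambda>\<kappa>. (LINT s|lborel. f s * g (\<phi> s) * exp (- \<kappa> * r s)) / (LINT s|lborel. f s * exp (- \<kappa> * r s)))
      \<longlongrightarrow> g p) at_top"
  proof (rule laplace_ratio_tendsto)
    show "f \<in> borel_measurable lborel" "r \<in> borel_measurable lborel"
      "(\<lambda>s. g (\<phi> s)) \<in> borel_measurable lborel"
      by (intro meas cont_f cont_r continuous_on_compose2[OF g(1) \<phi>(1)] subset_UNIV)+
    show "0 \<le> r s" for s using t by (simp add: r_def)
    show "integrable lborel (\<lambda>s. f s * exp (- r s))"
    proof (rule Bochner_Integration.integrable_bound)
      show "integrable lborel (\<lambda>s. M * exp (- (1 / (2 * t)) * (norm (\<phi> s - p))\<^sup>2))"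
        using t \<phi> by (intro integrable_mult_right integrable_gaussian_perturbation) auto
      show "(\<lambda>s. f s * exp (- r s)) \<in> borel_measurable lborel"
        by (intro meas continuous_intros cont_f cont_r)
      have "\<bar>f s\<bar> \<le> \<bar>M\<bar>" for s using M[of s] by linarith
      then show "AE s in lborel. norm (f s * exp (- r s)) \<le> norm (M * exp (- (1 / (2 * t)) * (norm (\<phi> s - p))\<^sup>2))"
        by (simp add: r_def abs_mult)
    qed
    show "emeasure lborel {s \<in> space lborel. r s < d} \<noteq> 0" if "d > 0" for d
    proof -
      \<comment> \<open>The sublevel set is open and contains the preimage \<open>s0\<close> of
        \<open>p\<close>, hence has positive Lebesgue measure; this is where surjectivity
        enters.\<close>
      have "open {s. r s < d}"
        using cont_r by (intro open_Collect_less) auto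
      moreover have "s0 \<in> {s. r s < d}" using that s0 by (simp add: r_def)
      ultimately have "{s. r s < d} \<notin> null_sets lborel"
        using open_not_negligible[of "{s. r s < d}"] negligible_iff_null_sets null_sets_completionI by blast
      moreover have "{s. r s < d} \<in> sets lborel" using \<open>open {s. r s < d}\<close> by simp
      ultimately show ?thesis by (auto simp: null_sets_def)
    qed
    show "\<exists>d>0. \<forall>s. r s < d \<longrightarrow> \<bar>g (\<phi> s) - g p\<bar> \<le> e" if "e > 0" for e
    proof -
      obtain \<delta> where \<delta>: "\<delta> > 0" "\<And>z. dist z p < \<delta> \<Longrightarrow> dist (g z) (g p) < e"
        using g(1) \<open>e > 0\<close> unfolding continuous_on_iff by (metis UNIV_I)
      have "\<bar>g (\<phi> s) - g p\<bar> \<le> e" if "r s < \<delta>\<^sup>2 / (2 * t)" for s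
      proof -
        have "(norm (\<phi> s - p))\<^sup>2 < \<delta>\<^sup>2" using that t by (simp add: r_def divide_less_cancel)
        then have "norm (\<phi> s - p) < \<delta>" using \<delta>(1) by (simp add: power2_less_imp_less)
        then show ?thesis using \<delta>(2)[of "\<phi> s"] by (simp add: dist_norm)
      qed
      then show ?thesis using \<delta>(1) t by (intro exI[of _ "\<delta>\<^sup>2 / (2 * t)"]) auto
    qed
  qed (use f g in auto)
  moreover have "filterlim (\<lambda>\<sigma>::real. inverse (\<sigma>\<^sup>2)) at_top (at_right 0)"
    by (rule filterlim_compose[OF filterlim_inverse_at_top_right])
      (auto simp: filterlim_at eventually_at_filter intro!: tendsto_eq_intros)
  ultimately show ?thesis
    unfolding r_eq by (rule filterlim_compose)
qed

section \<open>The zero-noise limit for the transport system\<close>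

theorem theorem2:
  fixes l T :: real
    and u0 v0 f0 :: "real \<times> real \<Rightarrow> real"
    and u v :: "real \<Rightarrow> real \<Rightarrow> real \<Rightarrow> real"
  assumes "l > 0"
    and "C1_on UNIV u0" "u0 \<in> bcontfun"
    and "C1_on UNIV v0" "v0 \<in> bcontfun"
    and "C1_on UNIV f0" "f0 \<in> bcontfun"
    and "\<And>s. f0 s > 0"
    and "classical_solution l u0 v0 T u v"
  shows "\<forall>t x y. 0 < t \<and> t < T \<longrightarrow>
    ((\<lambda>\<sigma>. (u_hat l u0 v0 f0 \<sigma> t x y, v_hat l u0 v0 f0 \<sigma> t x y)) \<longlongrightarrow> (u t x y, v t x y)) (at_right 0)"
proof (intro allI impI)
  fix t x y assume t: "0 < t \<and> t < T"
  let ?\<phi> = "flow l u0 v0 t" and ?u = "\<lambda>(x, y). u t x y" and ?v = "\<lambda>(x, y). v t x y"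
  have cont0: "continuous_on UNIV u0" "continuous_on UNIV v0"
    using assms by (auto simp: bcontfun_def)
  obtain Mu Mv where Mu: "\<And>s. \<bar>u0 s\<bar> \<le> Mu" and Mv: "\<And>s. \<bar>v0 s\<bar> \<le> Mv"
    using assms(3,5) by (auto simp: bcontfun_def bounded_iff)
  have combination: "\<bar>a * cos \<theta> + b * sin \<theta>\<bar> \<le> \<bar>a\<bar> + \<bar>b\<bar>" for a b \<theta> :: real
    by (rule order_trans[OF abs_triangle_ineq])
      (auto simp: abs_mult intro!: add_mono mult_left_le)
  have q: "\<bar>q1 l u0 v0 t s\<bar> \<le> Mu + Mv" "\<bar>q2 l u0 v0 t s\<bar> \<le> Mu + Mv" for s
    using combination[of "u0 s" "l * t" "v0 s"] combination[of "v0 s" "l * t" "- u0 s"] Mu[of s] Mv[of s]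
    by (auto simp: q1_def q2_def)
  have cont_flow: "continuous_on UNIV ?\<phi>"
    unfolding flow_def[abs_def] q1_def q2_def using \<open>l > 0\<close> by (intro continuous_intros cont0) auto
  \<comment> \<open>The two displacements are at most \<open>(Mu + 2 * Mv) / l\<close> and
    \<open>(2 * Mu + Mv) / l\<close>; their sum gives the constant.\<close>
  have bound_flow: "norm (?\<phi> s - s) \<le> 3 * (Mu + Mv) / l" for s
  proof -
    have "norm (?\<phi> s - s) \<le> \<bar>fst (?\<phi> s - s)\<bar> + \<bar>snd (?\<phi> s - s)\<bar>"
      using norm_Pair_le[of "fst (?\<phi> s - s)" "snd (?\<phi> s - s)"]
      by (simp only: prod.collapse real_norm_def)
    also have "\<dots> = (\<bar>- q2 l u0 v0 t s + v0 s\<bar> + \<bar>q1 l u0 v0 t s - u0 s\<bar>) / l"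
      using \<open>l > 0\<close> by (simp add: flow_def abs_divide add_divide_distrib)
    also have "\<dots> \<le> 3 * (Mu + Mv) / l"
    proof (rule divide_right_mono)
      have "\<bar>- q2 l u0 v0 t s + v0 s\<bar> \<le> Mu + 2 * Mv" using q(2)[of s] Mv[of s] by linarith
      moreover have "\<bar>q1 l u0 v0 t s - u0 s\<bar> \<le> 2 * Mu + Mv" using q(1)[of s] Mu[of s] by linarith
      ultimately have "\<bar>- q2 l u0 v0 t s + v0 s\<bar> + \<bar>q1 l u0 v0 t s - u0 s\<bar>
          \<le> (Mu + 2 * Mv) + (2 * Mu + Mv)"
        by (rule add_mono)
      then show "\<bar>- q2 l u0 v0 t s + v0 s\<bar> + \<bar>q1 l u0 v0 t s - u0 s\<bar> \<le> 3 * (Mu + Mv)"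
        by simp
    qed (use \<open>l > 0\<close> in simp)
    finally show ?thesis .
  qed
  have along: "?u (?\<phi> s) = q1 l u0 v0 t s" "?v (?\<phi> s) = q2 l u0 v0 t s" for s
    using classical_solution_along_flow[OF assms(1,9), of t s] t by auto
  have H: "H l u0 v0 \<sigma> t s x y = exp (- ((norm (?\<phi> s - (x, y)))\<^sup>2 / (2 * \<sigma>\<^sup>2 * t)))" for \<sigma> s
    by (simp add: H_def flow_def norm_Pair add.commute)
  have C1_cont: "continuous_on UNIV (\<lambda>(x, y). w t x y)"
    if "C1_on ({0..<T} \<times> UNIV) (\<lambda>(t, x, y). w t x y)" for w :: "real \<Rightarrow> real \<Rightarrow> real \<Rightarrow> real"
  proof -
    have "continuous_on UNIV (\<lambda>z. (\<lambda>(t, x, y). w t x y) (t, z :: real \<times> real))"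
      by (rule continuous_on_compose2[OF C1_on_imp_continuous_on[OF that]])
        (use t in \<open>auto intro!: continuous_on_Pair continuous_on_const continuous_on_id\<close>)
    then show ?thesis by (simp add: case_prod_beta')
  qed
  have cont: "continuous_on UNIV ?u" "continuous_on UNIV ?v"
    using assms(9) C1_cont unfolding classical_solution_def by blast+
  note average = gaussian_average_tendsto[OF conjunct1[OF t] cont_flow bound_flow assms(7,8)]
  have "((\<lambda>\<sigma>. u_hat l u0 v0 f0 \<sigma> t x y) \<longlongrightarrow> ?u (x, y)) (at_right 0)"
    \<comment> \<open>Reading \<open>along\<close> backwards replaces \<open>q1\<close> by
      \<open>u\<close> at the flow point, which makes the ratio an average of
      \<open>g (\<phi> s)\<close>; the bound on \<open>q1\<close> serves as
      \<open>B\<close>.\<close>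
    unfolding u_hat_def H along[symmetric]
    by (rule average[OF cont(1), where B = "Mu + Mv"]) (simp only: along q)
  moreover have "((\<lambda>\<sigma>. v_hat l u0 v0 f0 \<sigma> t x y) \<longlongrightarrow> ?v (x, y)) (at_right 0)"
    unfolding v_hat_def H along[symmetric]
    by (rule average[OF cont(2), where B = "Mu + Mv"]) (simp only: along q)
  ultimately show "((\<lambda>\<sigma>. (u_hat l u0 v0 f0 \<sigma> t x y, v_hat l u0 v0 f0 \<sigma> t x y)) \<longlongrightarrow> (u t x y, v t x y)) (at_right 0)"
    by (intro tendsto_Pair) simp_all
qed

end
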